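(* Let $L$ be a bounded lattice with unary operations $\neg,\Box,\Diamond$ such that $\neg$ is dually self-adjoint with $\neg1=0$, $\Box$ is multiplicative, $\Diamond$ is additive, and $\Diamond\neg a\leq\neg\Box a$ for all $a\in L$. Define $X$ to be the set of pairs $(F,I)$ with $F$ a filter in $L$, $I$ an ideal in $L$, and $\{\neg a\mid a\in F\}\subseteq I$; $(F,I)\vartriangleleft(F',I')$ iff $I\cap F'=\varnothing$; $(F,I)R(F',I')$ iff for all $a\in L$, ($\Box a\in F\Rightarrow a\in F'$) and ($\Diamond a\in I\Rightarrow a\in I'$); and $Q=R$. Then: (1) $\mathcal{F}=(X,\vartriangleleft,R,Q)$ is a unified, additive modal frame with $\vartriangleleft$ pseudo-symmetric; (2) there is an embedding of $(L,\neg,\Box,\Diamond)$ into $(\mathfrak{L}(X,\vartriangleleft),\neg_\vartriangleleft,\Box_R,\Diamond_Q)$, and $(L,\neg,\Box,\Diamond)$ is isomorphic to the subalgebra of $(\mathfrak{L}(X,\vartriangleleft),\neg_\vartriangleleft,\Box_R,\Diamond_Q)$ consisting of the $c_\vartriangleleft$-fixpoints that are compact open in the topology on $X$ generated by $\{\widehat{a}\mid a\in L\}$, where $\widehat{a}=\{(F,I)\in X\mid a\in F\}$; (3) if $a\wedge\neg a=0$ for all $a\in L$, then $\vartriangleleft$ is pseudo-reflexive; (4) if $\neg\Diamond a\leq\Box\neg a$ for all $a\in L$, then $\mathcal{F}$ is negative.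
   Context: Dually self-adjoint: $a\leq\neg b$ implies $b\leq\neg a$. Multiplicative: $\Box$ preserves finite meets; additive: $\Diamond$ preserves finite joins. A modal frame is $(X,\vartriangleleft,R,Q)$ with $X$ nonempty and binary relations such that for all $x,y,z$: if $xRy$ and $z\vartriangleleft y$, then there is $x'\vartriangleleft x$ such that for all $x''$ with $x'\vartriangleleft x''$ there is $y''$ with $x''Ry''$ and $z\vartriangleleft y''$. It is unified if $R=Q$; additive if for all $x,y,z$: if $xQy$ and $y\vartriangleleft z$ then there is $x'$ with $x\vartriangleleft x'$ such that for all $x''\vartriangleleft x'$ there is $y''$ with $x''Qy''$ and $y''\vartriangleleft z$; negative if for all $x,y,z$: if $xRy$ and $z\vartriangleleft y$ then there is $x'\vartriangleleft x$ such that for all $x''\vartriangleleft x'$ there is $y''$ with $x''Qy''$ and $y''\vartriangleleft z$. Say $z$ pre-refines $x$ if every $w\vartriangleleft z$ satisfies $w\vartriangleleft x$; $x$ is non-absurd if some $y\vartriangleleft x$. $\vartriangleleft$ is pseudo-reflexive if every non-absurd $x$ has some $z\vartriangleleft x$ that pre-refines $x$; pseudo-symmetric if for all $x$ and $y\vartriangleleft x$ there is $z\vartriangleleft y$ that pre-refines $x$. ($u\vartriangleright v$ means $v\vartriangleleft u$.) $c_\vartriangleleft(A)=\{x\mid \forall y\vartriangleleft x\ \exists z\vartriangleright y: z\in A\}$; $\mathfrak{L}(X,\vartriangleleft)$ is the complete lattice of its fixpoints (meet = intersection, join = $c_\vartriangleleft$ of union). $\neg_\vartriangleleft A=\{x\mid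 \forall y\vartriangleleft x,\ y\notin A\}$; $\Box_RA=\{x\mid \forall y(xRy\Rightarrow y\in A)\}$; $\Diamond_QA=\{x\mid \forall x'\vartriangleleft x\ \exists y'\,(x'Qy')\ \exists y\vartriangleright y': y\in A\}$. An embedding is an injective map preserving $\wedge,\vee,0,1,\neg,\Box,\Diamond$. *)

theory Defs
  imports "HOL-Analysis.Analysis"
begin

section \<open>Unary operations on a bounded lattice\<close>

definition dually_self_adjoint :: "('a::bounded_lattice \<Rightarrow> 'a) \<Rightarrow> bool" where
  "dually_self_adjoint Neg \<longleftrightarrow> (\<forall>a b. a \<le> Neg b \<longrightarrow> b \<le> Neg a)"

text \<open>Finite meets and joins include the empty ones, hence the clauses for \<open>top\<close> and \<open>bot\<close>.\<close>

definition multiplicative_op :: "('a::bounded_lattice \<Rightarrow> 'a) \<Rightarrow> bool" where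
  "multiplicative_op Box \<longleftrightarrow> Box top = top \<and> (\<forall>a b. Box (inf a b) = inf (Box a) (Box b))"

definition additive_op :: "('a::bounded_lattice \<Rightarrow> 'a) \<Rightarrow> bool" where
  "additive_op Dia \<longleftrightarrow> Dia bot = bot \<and> (\<forall>a b. Dia (sup a b) = sup (Dia a) (Dia b))"

text \<open>Filters and ideals are nonempty but may be improper.\<close>

definition lattice_filter :: "'a::bounded_lattice set \<Rightarrow> bool" where
  "lattice_filter F \<longleftrightarrow>
     F \<noteq> {} \<and> (\<forall>a\<in>F. \<forall>b. a \<le> b \<longrightarrow> b \<in> F) \<and> (\<forall>a\<in>F. \<forall>b\<in>F. inf a b \<in> F)"

definition lattice_ideal :: "'a::bounded_lattice set \<Rightarrow> bool" where
  "lattice_ideal I \<longleftrightarrow>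
     I \<noteq> {} \<and> (\<forall>a\<in>I. \<forall>b. b \<le> a \<longrightarrow> b \<in> I) \<and> (\<forall>a\<in>I. \<forall>b\<in>I. sup a b \<in> I)"


section \<open>Modal frames\<close>

text \<open>The points of a frame form a set \<open>X\<close>; relations are only ever consulted on \<open>X\<close>,
  and every quantifier over points is relativised to it.\<close>

context
  fixes X :: "'x set"
    and below :: "'x \<Rightarrow> 'x \<Rightarrow> bool"  (infix "\<lhd>" 50)
begin

definition modal_frame :: "('x \<Rightarrow> 'x \<Rightarrow> bool) \<Rightarrow> ('x \<Rightarrow> 'x \<Rightarrow> bool) \<Rightarrow> bool" where
  "modal_frame R Q \<longleftrightarrow> X \<noteq> {} \<and>
     (\<forall>x\<in>X. \<forall>y\<in>X. \<forall>z\<in>X. R x y \<and> z \<lhd> y \<longrightarrow>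
        (\<exists>x'\<in>X. x' \<lhd> x \<and>
           (\<forall>x''\<in>X. x' \<lhd> x'' \<longrightarrow> (\<exists>y''\<in>X. R x'' y'' \<and> z \<lhd> y''))))"

definition additive_frame :: "('x \<Rightarrow> 'x \<Rightarrow> bool) \<Rightarrow> ('x \<Rightarrow> 'x \<Rightarrow> bool) \<Rightarrow> bool" where
  "additive_frame R Q \<longleftrightarrow>
     (\<forall>x\<in>X. \<forall>y\<in>X. \<forall>z\<in>X. Q x y \<and> y \<lhd> z \<longrightarrow>
        (\<exists>x'\<in>X. x \<lhd> x' \<and>
           (\<forall>x''\<in>X. x'' \<lhd> x' \<longrightarrow> (\<exists>y''\<in>X. Q x'' y'' \<and> y'' \<lhd> z))))"

definition negative_frame :: "('x \<Rightarrow> 'x \<Rightarrow> bool) \<Rightarrow> ('x \<Rightarrow> 'x \<Rightarrow> bool) \<Rightarrow> bool" where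
  "negative_frame R Q \<longleftrightarrow>
     (\<forall>x\<in>X. \<forall>y\<in>X. \<forall>z\<in>X. R x y \<and> z \<lhd> y \<longrightarrow>
        (\<exists>x'\<in>X. x' \<lhd> x \<and>
           (\<forall>x''\<in>X. x'' \<lhd> x' \<longrightarrow> (\<exists>y''\<in>X. Q x'' y'' \<and> y'' \<lhd> z))))"

definition pre_refines :: "'x \<Rightarrow> 'x \<Rightarrow> bool" where
  "pre_refines z x \<longleftrightarrow> (\<forall>w\<in>X. w \<lhd> z \<longrightarrow> w \<lhd> x)"

definition non_absurd :: "'x \<Rightarrow> bool" where
  "non_absurd x \<longleftrightarrow> (\<exists>y\<in>X. y \<lhd> x)"

definition pseudo_reflexive :: bool where
  "pseudo_reflexive \<longleftrightarrow> (\<forall>x\<in>X. non_absurd x \<longrightarrow> (\<exists>z\<in>X. z \<lhd> x \<and> pre_refines z x))"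

definition pseudo_symmetric :: bool where
  "pseudo_symmetric \<longleftrightarrow>
     (\<forall>x\<in>X. \<forall>y\<in>X. y \<lhd> x \<longrightarrow> (\<exists>z\<in>X. z \<lhd> y \<and> pre_refines z x))"

definition frame_closure :: "'x set \<Rightarrow> 'x set" where
  "frame_closure A = {x\<in>X. \<forall>y\<in>X. y \<lhd> x \<longrightarrow> (\<exists>z\<in>X. y \<lhd> z \<and> z \<in> A)}"

definition frame_fixpoints :: "'x set set" where
  "frame_fixpoints = {A. A \<subseteq> X \<and> frame_closure A = A}"

definition frame_neg :: "'x set \<Rightarrow> 'x set" where
  "frame_neg A = {x\<in>X. \<forall>y\<in>X. y \<lhd> x \<longrightarrow> y \<notin> A}"

definition frame_box :: "('x \<Rightarrow> 'x \<Rightarrow> bool) \<Rightarrow> 'x set \<Rightarrow> 'x set" where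
  "frame_box R A = {x\<in>X. \<forall>y\<in>X. R x y \<longrightarrow> y \<in> A}"

definition frame_dia :: "('x \<Rightarrow> 'x \<Rightarrow> bool) \<Rightarrow> 'x set \<Rightarrow> 'x set" where
  "frame_dia Q A =
     {x\<in>X. \<forall>x'\<in>X. x' \<lhd> x \<longrightarrow> (\<exists>y'\<in>X. Q x' y' \<and> (\<exists>y\<in>X. y' \<lhd> y \<and> y \<in> A))}"

end

definition unified_frame :: "'x set \<Rightarrow> ('x \<Rightarrow> 'x \<Rightarrow> bool) \<Rightarrow> ('x \<Rightarrow> 'x \<Rightarrow> bool) \<Rightarrow> bool" where
  "unified_frame X R Q \<longleftrightarrow> (\<forall>x\<in>X. \<forall>y\<in>X. R x y \<longleftrightarrow> Q x y)"


section \<open>Algebras, embeddings, subalgebras\<close>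

text \<open>A common signature for the abstract lattice expansion (carried by a type) and the concrete
  algebra of fixpoints (carried by a set).\<close>

record 'b modal_algebra =
  alg_carrier :: "'b set"
  alg_meet :: "'b \<Rightarrow> 'b \<Rightarrow> 'b"
  alg_join :: "'b \<Rightarrow> 'b \<Rightarrow> 'b"
  alg_zero :: 'b
  alg_one :: 'b
  alg_neg :: "'b \<Rightarrow> 'b"
  alg_box :: "'b \<Rightarrow> 'b"
  alg_dia :: "'b \<Rightarrow> 'b"

definition lattice_algebra ::
  "('a::bounded_lattice \<Rightarrow> 'a) \<Rightarrow> ('a \<Rightarrow> 'a) \<Rightarrow> ('a \<Rightarrow> 'a) \<Rightarrow> 'a modal_algebra" where
  "lattice_algebra Neg Box Dia =
     \<lparr>alg_carrier = UNIV, alg_meet = inf, alg_join = sup, alg_zero = bot, alg_one = top,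
      alg_neg = Neg, alg_box = Box, alg_dia = Dia\<rparr>"

definition fixpoint_algebra ::
  "'x set \<Rightarrow> ('x \<Rightarrow> 'x \<Rightarrow> bool) \<Rightarrow> ('x \<Rightarrow> 'x \<Rightarrow> bool) \<Rightarrow> ('x \<Rightarrow> 'x \<Rightarrow> bool)
    \<Rightarrow> 'x set modal_algebra" where
  "fixpoint_algebra X below R Q =
     \<lparr>alg_carrier = frame_fixpoints X below,
      alg_meet = (\<inter>),
      alg_join = (\<lambda>A B. frame_closure X below (A \<union> B)),
      alg_zero = frame_closure X below {},
      alg_one = X,
      alg_neg = frame_neg X below,
      alg_box = frame_box X R,
      alg_dia = frame_dia X below Q\<rparr>"

definition is_embedding :: "('b \<Rightarrow> 'c) \<Rightarrow> 'b modal_algebra \<Rightarrow> 'c modal_algebra \<Rightarrow> bool" where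
  "is_embedding f A B \<longleftrightarrow>
     f ` alg_carrier A \<subseteq> alg_carrier B \<and> inj_on f (alg_carrier A) \<and>
     f (alg_zero A) = alg_zero B \<and> f (alg_one A) = alg_one B \<and>
     (\<forall>a\<in>alg_carrier A. \<forall>b\<in>alg_carrier A.
        f (alg_meet A a b) = alg_meet B (f a) (f b) \<and>
        f (alg_join A a b) = alg_join B (f a) (f b)) \<and>
     (\<forall>a\<in>alg_carrier A.
        f (alg_neg A a) = alg_neg B (f a) \<and>
        f (alg_box A a) = alg_box B (f a) \<and>
        f (alg_dia A a) = alg_dia B (f a))"

definition isomorphic_algebras :: "'b modal_algebra \<Rightarrow> 'c modal_algebra \<Rightarrow> bool" where
  "isomorphic_algebras A B \<longleftrightarrow>
     (\<exists>f. is_embedding f A B \<and> f ` alg_carrier A = alg_carrier B)"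

definition is_subalgebra :: "'b set \<Rightarrow> 'b modal_algebra \<Rightarrow> bool" where
  "is_subalgebra S B \<longleftrightarrow>
     S \<subseteq> alg_carrier B \<and> alg_zero B \<in> S \<and> alg_one B \<in> S \<and>
     (\<forall>a\<in>S. \<forall>b\<in>S. alg_meet B a b \<in> S \<and> alg_join B a b \<in> S) \<and>
     (\<forall>a\<in>S. alg_neg B a \<in> S \<and> alg_box B a \<in> S \<and> alg_dia B a \<in> S)"

definition restrict_algebra :: "'b modal_algebra \<Rightarrow> 'b set \<Rightarrow> 'b modal_algebra" where
  "restrict_algebra B S = B\<lparr>alg_carrier := S\<rparr>"

text \<open>The fixpoints of a modal frame are closed under all the operations, so
  \<^const>\<open>fixpoint_algebra\<close> is an algebra, and its meet and join are those of inclusion.\<close>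

lemma frame_closure_mono: "A \<subseteq> B \<Longrightarrow> frame_closure X below A \<subseteq> frame_closure X below B"
  unfolding frame_closure_def by blast

lemma frame_closure_extensive: "A \<subseteq> X \<Longrightarrow> A \<subseteq> frame_closure X below A"
  unfolding frame_closure_def by blast

lemma frame_closure_fixpoint: "frame_closure X below A \<in> frame_fixpoints X below"
  unfolding frame_fixpoints_def frame_closure_def by blast

lemma fixpoint_algebra_join_least:
  assumes "A \<in> frame_fixpoints X below" "B \<in> frame_fixpoints X below" "C \<in> frame_fixpoints X below"
  shows "frame_closure X below (A \<union> B) \<subseteq> C \<longleftrightarrow> A \<subseteq> C \<and> B \<subseteq> C"
  using assms frame_closure_mono[of "A \<union> B" C X below]
    frame_closure_extensive[of "A \<union> B" X below]
  unfolding frame_fixpoints_def by auto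

lemma fixpoint_algebra_closed:
  assumes "modal_frame X below R Q"
  shows "is_subalgebra (frame_fixpoints X below) (fixpoint_algebra X below R Q)"
proof -
  have clI: "A \<in> frame_fixpoints X below" if "A \<subseteq> X" "frame_closure X below A \<subseteq> A" for A
    using that frame_closure_extensive[of A X below] unfolding frame_fixpoints_def by auto
  have one: "X \<in> frame_fixpoints X below"
    by (rule clI) (auto simp: frame_closure_def)
  have meet: "A \<inter> B \<in> frame_fixpoints X below"
    if "A \<in> frame_fixpoints X below" "B \<in> frame_fixpoints X below" for A B
    using that frame_closure_mono[of "A \<inter> B" A X below] frame_closure_mono[of "A \<inter> B" B X below]
    by (intro clI) (auto simp: frame_fixpoints_def)
  have fneg: "frame_neg X below A \<in> frame_fixpoints X below" for A
    by (rule clI) (auto simp: frame_neg_def frame_closure_def)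
  have fdia: "frame_dia X below Q A \<in> frame_fixpoints X below" for A
  proof (rule clI)
    show "frame_dia X below Q A \<subseteq> X" unfolding frame_dia_def by blast
    show "frame_closure X below (frame_dia X below Q A) \<subseteq> frame_dia X below Q A"
    proof
      fix x assume x: "x \<in> frame_closure X below (frame_dia X below Q A)"
      have "\<exists>y'\<in>X. Q x' y' \<and> (\<exists>y\<in>X. below y' y \<and> y \<in> A)" if x': "x' \<in> X" "below x' x" for x'
      proof -
        obtain z where "z \<in> X" "below x' z" "z \<in> frame_dia X below Q A"
          using x x' unfolding frame_closure_def by blast
        then show ?thesis using x'(1) unfolding frame_dia_def by simp
      qed
      moreover have "x \<in> X" using x unfolding frame_closure_def by simp
      ultimately show "x \<in> frame_dia X below Q A" unfolding frame_dia_def by simp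
    qed
  qed
  have fbox: "frame_box X R A \<in> frame_fixpoints X below" if A: "A \<in> frame_fixpoints X below" for A
  proof (rule clI)
    show "frame_box X R A \<subseteq> X" by (auto simp: frame_box_def)
    show "frame_closure X below (frame_box X R A) \<subseteq> frame_box X R A"
    proof
      fix x assume x: "x \<in> frame_closure X below (frame_box X R A)"
      have "y \<in> A" if y: "y \<in> X" "R x y" for y
      proof -
        have "\<exists>w\<in>X. below z w \<and> w \<in> A" if z: "z \<in> X" "below z y" for z
        proof -
          obtain x' where x': "x' \<in> X" "below x' x"
            and up: "\<forall>x''\<in>X. below x' x'' \<longrightarrow> (\<exists>y''\<in>X. R x'' y'' \<and> below z y'')"
            using assms x y z unfolding modal_frame_def frame_closure_def by blast
          then obtain x'' where "x'' \<in> X" "below x' x''" "x'' \<in> frame_box X R A"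
            using x unfolding frame_closure_def by blast
          with up show ?thesis unfolding frame_box_def by blast
        qed
        then have "y \<in> frame_closure X below A" using y by (auto simp: frame_closure_def)
        then show ?thesis using A by (simp add: frame_fixpoints_def)
      qed
      then show "x \<in> frame_box X R A" using x by (auto simp: frame_box_def frame_closure_def)
    qed
  qed
  show ?thesis
    unfolding is_subalgebra_def fixpoint_algebra_def
    using one meet fneg fdia fbox by (simp add: frame_closure_fixpoint)
qed


section \<open>The frame of filter-ideal pairs\<close>

definition pair_states :: "('a::bounded_lattice \<Rightarrow> 'a) \<Rightarrow> ('a set \<times> 'a set) set" where
  "pair_states Neg = {(F, I). lattice_filter F \<and> lattice_ideal I \<and> {Neg a | a. a \<in> F} \<subseteq> I}"

definition pair_below :: "'a set \<times> 'a set \<Rightarrow> 'a set \<times> 'a set \<Rightarrow> bool" where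
  "pair_below = (\<lambda>(F, I) (F', I'). I \<inter> F' = {})"

definition pair_rel :: "('a \<Rightarrow> 'a) \<Rightarrow> ('a \<Rightarrow> 'a) \<Rightarrow> 'a set \<times> 'a set \<Rightarrow> 'a set \<times> 'a set \<Rightarrow> bool" where
  "pair_rel Box Dia =
     (\<lambda>(F, I) (F', I'). \<forall>a. (Box a \<in> F \<longrightarrow> a \<in> F') \<and> (Dia a \<in> I \<longrightarrow> a \<in> I'))"

definition hat :: "('a::bounded_lattice \<Rightarrow> 'a) \<Rightarrow> 'a \<Rightarrow> ('a set \<times> 'a set) set" where
  "hat Neg a = {(F, I) \<in> pair_states Neg. a \<in> F}"

text \<open>The space of this topology is all of \<open>pair_states Neg\<close>, since that is \<open>hat Neg top\<close>.\<close>

definition pair_topology :: "('a::bounded_lattice \<Rightarrow> 'a) \<Rightarrow> ('a set \<times> 'a set) topology" where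
  "pair_topology Neg = topology_generated_by {hat Neg a | a. True}"

lemma topspace_pair_topology: "topspace (pair_topology Neg) = pair_states Neg"
proof -
  have "top \<in> F" if "lattice_filter F" for F :: "'a set"
    using that unfolding lattice_filter_def by (meson all_not_in_conv top_greatest)
  then have "hat Neg top = pair_states Neg"
    unfolding hat_def pair_states_def by blast
  moreover have "hat Neg a \<subseteq> pair_states Neg" for a
    unfolding hat_def by blast
  ultimately show ?thesis
    unfolding pair_topology_def topology_generated_by_topspace by blast
qed

definition compact_open_fixpoints :: "('a::bounded_lattice \<Rightarrow> 'a) \<Rightarrow> ('a set \<times> 'a set) set set" where
  "compact_open_fixpoints Neg =
     {U \<in> frame_fixpoints (pair_states Neg) pair_below.
        compactin (pair_topology Neg) U \<and> openin (pair_topology Neg) U}"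

end

(*
Every point (F, I) has a canonical R-successor, the pair of preimages of F under Box and of I
under Dia; it is a point because Dia (Neg a) <= Neg (Box a). All existential frame conditions are
met by this successor together with points whose filter or ideal is as small as possible.
A join s of finitely many elements lies in an ideal exactly when those elements do, so
hat s is the closure of the union of their hats. Finally, (up a, down (Neg a)) is the least point of
hat a, hence every open cover of hat a has a member containing all of it.
*)
theory Submission
  imports Defs
begin

section \<open>Filters and ideals of a bounded lattice\<close>

lemma lattice_filter_top: "lattice_filter F \<Longrightarrow> top \<in> F"
  unfolding lattice_filter_def by (meson ex_in_conv top_greatest)

lemma lattice_ideal_bot: "lattice_ideal I \<Longrightarrow> bot \<in> I"
  unfolding lattice_ideal_def by (meson ex_in_conv bot_least)

lemma lattice_filter_up: "lattice_filter F \<Longrightarrow> a \<in> F \<Longrightarrow> a \<le> b \<Longrightarrow> b \<in> F"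
  unfolding lattice_filter_def by blast

lemma lattice_ideal_down: "lattice_ideal I \<Longrightarrow> a \<in> I \<Longrightarrow> b \<le> a \<Longrightarrow> b \<in> I"
  unfolding lattice_ideal_def by blast

lemma lattice_filter_inf: "lattice_filter F \<Longrightarrow> a \<in> F \<Longrightarrow> b \<in> F \<Longrightarrow> inf a b \<in> F"
  unfolding lattice_filter_def by blast

lemma lattice_ideal_sup_iff: "lattice_ideal I \<Longrightarrow> sup a b \<in> I \<longleftrightarrow> a \<in> I \<and> b \<in> I"
  unfolding lattice_ideal_def by (meson sup_ge1 sup_ge2)

lemma lattice_filter_upset: "lattice_filter {b. a \<le> b}" for a :: "'a::bounded_lattice"
  unfolding lattice_filter_def by auto

lemma lattice_filter_singleton_top: "lattice_filter {top :: 'a::bounded_lattice}"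
  unfolding lattice_filter_def by (auto simp: top_unique)

lemma lattice_ideal_downset: "lattice_ideal {b. b \<le> a}" for a :: "'a::bounded_lattice"
  unfolding lattice_ideal_def by auto

text \<open>Monotonicity suffices: \<open>f (inf a a')\<close> lies below both \<open>f a\<close>
  and \<open>f a'\<close>, so closure of \<open>F\<close> under meets carries over. This lets
  \<open>Dia\<close>, which preserves joins rather than meets, generate a filter; the dual lemma
  serves \<open>Box\<close> and ideals.\<close>

lemma lattice_filter_generated_image:
  assumes F: "lattice_filter F" and f: "mono f"
  shows "lattice_filter {b. \<exists>a\<in>F. f a \<le> b}"
  unfolding lattice_filter_def
proof (intro conjI ballI allI impI)
  show "{b. \<exists>a\<in>F. f a \<le> b} \<noteq> {}"
    using lattice_filter_top[OF F] by blast
next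
  fix b c assume "b \<in> {b. \<exists>a\<in>F. f a \<le> b}" "b \<le> c"
  then show "c \<in> {b. \<exists>a\<in>F. f a \<le> b}" by (auto intro: order_trans)
next
  fix b c assume "b \<in> {b. \<exists>a\<in>F. f a \<le> b}" "c \<in> {b. \<exists>a\<in>F. f a \<le> b}"
  then obtain a a' where a: "a \<in> F" "a' \<in> F" "f a \<le> b" "f a' \<le> c" by blast
  have "f (inf a a') \<le> inf b c"
    using a(3,4) monoD[OF f, of "inf a a'" a] monoD[OF f, of "inf a a'" a']
    by (meson inf.cobounded1 inf.cobounded2 le_inf_iff order_trans)
  then show "inf b c \<in> {b. \<exists>a\<in>F. f a \<le> b}"
    using lattice_filter_inf[OF F a(1,2)] by blast
qed

lemma lattice_ideal_generated_image:
  assumes I: "lattice_ideal I" and f: "mono f"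
  shows "lattice_ideal {b. \<exists>a\<in>I. b \<le> f a}"
  unfolding lattice_ideal_def
proof (intro conjI ballI allI impI)
  show "{b. \<exists>a\<in>I. b \<le> f a} \<noteq> {}"
    using lattice_ideal_bot[OF I] by blast
next
  fix b c assume "b \<in> {b. \<exists>a\<in>I. b \<le> f a}" "c \<le> b"
  then show "c \<in> {b. \<exists>a\<in>I. b \<le> f a}" by (auto intro: order_trans)
next
  fix b c assume "b \<in> {b. \<exists>a\<in>I. b \<le> f a}" "c \<in> {b. \<exists>a\<in>I. b \<le> f a}"
  then obtain a a' where a: "a \<in> I" "a' \<in> I" "b \<le> f a" "c \<le> f a'" by blast
  have "sup b c \<le> f (sup a a')"
    using a(3,4) monoD[OF f, of a "sup a a'"] monoD[OF f, of a' "sup a a'"]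
    by (meson sup.cobounded1 sup.cobounded2 le_sup_iff order_trans)
  moreover have "sup a a' \<in> I"
    using lattice_ideal_sup_iff[OF I] a by blast
  ultimately show "sup b c \<in> {b. \<exists>a\<in>I. b \<le> f a}" by blast
qed

lemma multiplicative_op_mono: "multiplicative_op f \<Longrightarrow> mono f"
  unfolding multiplicative_op_def by (intro monoI) (metis inf.absorb_iff1)

lemma additive_op_mono: "additive_op f \<Longrightarrow> mono f"
  unfolding additive_op_def by (intro monoI) (metis sup.absorb_iff2)

text \<open>The witness \<open>s\<close> is the join of \<open>A\<close>, with \<open>bot\<close>
  for the empty set. It is described through ideals because \<open>hat_join\<close> tests joins
  against ideals.\<close>

lemma finite_join_ideal:
  fixes A :: "'a::bounded_lattice set"
  assumes "finite A"
  shows "\<exists>s. \<forall>I. lattice_ideal I \<longrightarrow> (s \<in> I \<longleftrightarrow> A \<subseteq> I)"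
  using assms
proof induction
  case empty
  then show ?case using lattice_ideal_bot by blast
next
  case (insert a A)
  then obtain s where "\<forall>I. lattice_ideal I \<longrightarrow> (s \<in> I \<longleftrightarrow> A \<subseteq> I)" by blast
  then have "\<forall>I. lattice_ideal I \<longrightarrow> (sup a s \<in> I \<longleftrightarrow> insert a A \<subseteq> I)"
    by (simp add: lattice_ideal_sup_iff)
  then show ?case by blast
qed

section \<open>Points of the frame, using negation alone\<close>

locale neg_lattice =
  fixes Neg :: "'a::bounded_lattice \<Rightarrow> 'a"
  assumes dsa: "dually_self_adjoint Neg"
    and neg_top: "Neg top = bot"
begin

lemma neg_swap: "a \<le> Neg b \<Longrightarrow> b \<le> Neg a"
  using dsa unfolding dually_self_adjoint_def by blast

text \<open>Swapping \<open>Neg b <= Neg b\<close> gives \<open>b <= Neg (Neg b)\<close>; then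
  \<open>a <= Neg (Neg b)\<close> swaps to the claim.\<close>

lemma neg_antimono: "a \<le> b \<Longrightarrow> Neg b \<le> Neg a"
  by (meson neg_swap order_refl order_trans)

abbreviation "X \<equiv> pair_states Neg"

lemma pair_statesI:
  "lattice_filter F \<Longrightarrow> lattice_ideal I \<Longrightarrow> (\<And>a. a \<in> F \<Longrightarrow> Neg a \<in> I) \<Longrightarrow> (F, I) \<in> X"
  unfolding pair_states_def by auto

lemma pair_statesD:
  assumes "(F, I) \<in> X"
  shows "lattice_filter F" "lattice_ideal I" "a \<in> F \<Longrightarrow> Neg a \<in> I"
  using assms unfolding pair_states_def by auto

lemma pair_below_iff [simp]: "pair_below (F, I) (F', I') \<longleftrightarrow> I \<inter> F' = {}"
  unfolding pair_below_def by simp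

lemma hat_iff [simp]: "(F, I) \<in> hat Neg a \<longleftrightarrow> (F, I) \<in> X \<and> a \<in> F"
  unfolding hat_def by auto

lemma hat_subset: "hat Neg a \<subseteq> X"
  unfolding hat_def by auto

text \<open>With \<open>{top}\<close> as filter the only requirement is \<open>bot\<close> in
  \<open>I\<close>. Such points test filters: \<open>({top}, {b. b <= a})\<close> is below
  \<open>(F, I)\<close> exactly when \<open>a\<close> is not in \<open>F\<close>.\<close>

lemma ideal_state: "lattice_ideal I \<Longrightarrow> ({top}, I) \<in> X"
  by (rule pair_statesI) (auto simp: lattice_filter_singleton_top neg_top lattice_ideal_bot)

text \<open>This pairs \<open>F\<close> with the least ideal it admits. Joins stay inside because
  \<open>Neg a\<close> and \<open>Neg a'\<close> both lie below
  \<open>Neg (inf a a')\<close>.\<close>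

lemma filter_state:
  assumes F: "lattice_filter F"
  shows "(F, {b. \<exists>a\<in>F. b \<le> Neg a}) \<in> X"
proof (rule pair_statesI[OF F])
  show "lattice_ideal {b. \<exists>a\<in>F. b \<le> Neg a}"
    unfolding lattice_ideal_def
  proof (intro conjI ballI allI impI)
    show "{b. \<exists>a\<in>F. b \<le> Neg a} \<noteq> {}"
      using lattice_filter_top[OF F] by blast
  next
    fix b c assume "b \<in> {b. \<exists>a\<in>F. b \<le> Neg a}" "c \<le> b"
    then show "c \<in> {b. \<exists>a\<in>F. b \<le> Neg a}" by (auto intro: order_trans)
  next
    fix b c assume "b \<in> {b. \<exists>a\<in>F. b \<le> Neg a}" "c \<in> {b. \<exists>a\<in>F. b \<le> Neg a}"
    then obtain a a' where a: "a \<in> F" "a' \<in> F" "b \<le> Neg a" "c \<le> Neg a'" by blast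
    have "sup b c \<le> Neg (inf a a')"
      using a(3,4) neg_antimono[of "inf a a'" a] neg_antimono[of "inf a a'" a']
      by (meson inf.cobounded1 inf.cobounded2 le_sup_iff order_trans)
    then show "sup b c \<in> {b. \<exists>a\<in>F. b \<le> Neg a}"
      using lattice_filter_inf[OF F a(1,2)] by blast
  qed
qed auto

section \<open>The sets \<open>hat Neg a\<close> and the lattice operations with negation\<close>

lemma principal_state: "({b. a \<le> b}, {b. b \<le> Neg a}) \<in> X"
  by (rule pair_statesI) (auto simp: lattice_filter_upset lattice_ideal_downset neg_antimono)

text \<open>The principal point of \<open>a\<close> lies in \<open>hat Neg b\<close> exactly when
  \<open>a <= b\<close>, so it alone decides the inclusion.\<close>

lemma hat_subset_iff: "hat Neg a \<subseteq> hat Neg b \<longleftrightarrow> a \<le> b"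
proof
  assume "hat Neg a \<subseteq> hat Neg b"
  moreover have "({b. a \<le> b}, {b. b \<le> Neg a}) \<in> hat Neg a"
    using principal_state by simp
  ultimately have "({b. a \<le> b}, {b. b \<le> Neg a}) \<in> hat Neg b" by blast
  then show "a \<le> b" by simp
next
  assume "a \<le> b"
  then show "hat Neg a \<subseteq> hat Neg b"
    using lattice_filter_up pair_statesD(1) by (fastforce simp: hat_def)
qed

lemma inj_hat: "inj (hat Neg)"
  by (rule injI) (metis hat_subset_iff order_antisym order_refl)

text \<open>Leaving \<open>A\<close> arbitrary lets one proof serve empty, singleton, binary and
  finite joins.\<close>

lemma hat_join:
  assumes s: "\<And>I. lattice_ideal I \<Longrightarrow> s \<in> I \<longleftrightarrow> A \<subseteq> I"
  shows "frame_closure X pair_below (\<Union>a\<in>A. hat Neg a) = hat Neg s"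
proof (intro equalityI subsetI)
  fix x assume x: "x \<in> frame_closure X pair_below (\<Union>a\<in>A. hat Neg a)"
  obtain F I where FI: "x = (F, I)" by fastforce
  have xX: "(F, I) \<in> X" using x FI unfolding frame_closure_def by simp
  have "s \<in> F"
  proof (rule ccontr)
    assume "s \<notin> F"
    then have "{b. b \<le> s} \<inter> F = {}"
      using lattice_filter_up[OF pair_statesD(1)[OF xX]] by blast
    \<comment> \<open>The closure yields a point of some \<open>hat Neg a\<close> above this test
      point. But \<open>a <= s\<close> puts \<open>a\<close> in both the ideal of the one and the
      filter of the other.\<close>
    then have "pair_below ({top}, {b. b \<le> s}) x" using FI by simp
    then obtain z a where z: "pair_below ({top}, {b. b \<le> s}) z" "a \<in> A" "z \<in> hat Neg a"
      using x ideal_state[OF lattice_ideal_downset] unfolding frame_closure_def by blast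
    have "A \<subseteq> {b. b \<le> s}" using s[OF lattice_ideal_downset] by blast
    then show False using z by (cases z) auto
  qed
  then show "x \<in> hat Neg s" using FI xX by simp
next
  fix x assume x: "x \<in> hat Neg s"
  have "\<exists>z\<in>X. pair_below y z \<and> z \<in> (\<Union>a\<in>A. hat Neg a)"
    if y: "y \<in> X" "pair_below y x" for y
  proof -
    obtain F I where FI: "y = (F, I)" by fastforce
    have I: "lattice_ideal I" using y(1) FI pair_statesD by blast
    have "s \<notin> I" using x y FI by (cases x) auto
    \<comment> \<open>An ideal that misses the join misses a joinand \<open>a\<close>, whose
      principal point is then above \<open>y\<close>.\<close>
    then obtain a where a: "a \<in> A" "a \<notin> I" using s[OF I] by blast
    have "I \<inter> {b. a \<le> b} = {}" using a(2) lattice_ideal_down[OF I] by blast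
    then have "pair_below y ({b. a \<le> b}, {b. b \<le> Neg a})" using FI by simp
    moreover have "({b. a \<le> b}, {b. b \<le> Neg a}) \<in> hat Neg a"
      using principal_state by simp
    ultimately show ?thesis using a(1) principal_state by blast
  qed
  then show "x \<in> frame_closure X pair_below (\<Union>a\<in>A. hat Neg a)"
    using x hat_subset unfolding frame_closure_def by blast
qed

lemma hat_bot: "frame_closure X pair_below {} = hat Neg bot"
  using hat_join[of bot "{}"] by (simp add: lattice_ideal_bot)

lemma hat_sup:
  "frame_closure X pair_below (hat Neg a \<union> hat Neg b) = hat Neg (sup a b)"
  using hat_join[of "sup a b" "{a, b}"] by (simp add: lattice_ideal_sup_iff)

lemma hat_fixpoint: "hat Neg a \<in> frame_fixpoints X pair_below"
  using hat_join[of a "{a}"] hat_subset unfolding frame_fixpoints_def by simp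

lemma hat_top: "hat Neg top = X"
  using lattice_filter_top pair_statesD(1) by (fastforce simp: hat_def)

lemma hat_inf: "hat Neg (inf a b) = hat Neg a \<inter> hat Neg b"
proof -
  have "inf a b \<in> F \<longleftrightarrow> a \<in> F \<and> b \<in> F" if "(F, I) \<in> X" for F I
    using pair_statesD(1)[OF that] lattice_filter_inf lattice_filter_up
    by (meson inf.cobounded1 inf.cobounded2)
  then show ?thesis unfolding hat_def by auto
qed

lemma hat_neg: "hat Neg (Neg a) = frame_neg X pair_below (hat Neg a)"
proof (intro equalityI subsetI)
  fix x assume x: "x \<in> hat Neg (Neg a)"
  have "y \<notin> hat Neg a" if "pair_below y x" for y
    using x that pair_statesD(3) by (cases x; cases y) auto
  then show "x \<in> frame_neg X pair_below (hat Neg a)"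
    using x hat_subset unfolding frame_neg_def by blast
next
  fix x assume x: "x \<in> frame_neg X pair_below (hat Neg a)"
  obtain F I where FI: "x = (F, I)" by fastforce
  have xX: "(F, I) \<in> X" using x FI unfolding frame_neg_def by simp
  \<comment> \<open>The principal point is in \<open>hat Neg a\<close>, so it cannot be below
    \<open>x\<close>: some element under \<open>Neg a\<close> must lie in \<open>F\<close>.\<close>
  have "\<not> pair_below ({b. a \<le> b}, {b. b \<le> Neg a}) x"
    using x principal_state[of a] unfolding frame_neg_def by auto
  then have "Neg a \<in> F"
    using lattice_filter_up[OF pair_statesD(1)[OF xX]] FI by auto
  then show "x \<in> hat Neg (Neg a)" using FI xX by simp
qed

section \<open>Topology: compact open fixpoints are exactly the hats\<close>

lemma hat_basis:
  assumes "openin (pair_topology Neg) U" "x \<in> U"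
  shows "\<exists>a. x \<in> hat Neg a \<and> hat Neg a \<subseteq> U"
proof -
  have "generate_topology_on {hat Neg a | a. True} U"
    using assms(1) unfolding pair_topology_def openin_topology_generated_by_iff .
  then show ?thesis using assms(2)
  proof (induction arbitrary: x)
    \<comment> \<open>Hats are closed under binary intersection, so the generating family is already
      a basis.\<close>
    case (Int U V)
    then obtain a b where "x \<in> hat Neg a" "hat Neg a \<subseteq> U" "x \<in> hat Neg b" "hat Neg b \<subseteq> V"
      by (meson IntD1 IntD2)
    then show ?case by (intro exI[of _ "inf a b"]) (auto simp: hat_inf)
  next
    case (UN K)
    then obtain U where "U \<in> K" "x \<in> U" by blast
    with UN.IH[of U x] show ?case by blast
  qed auto
qed

lemma openin_hat: "openin (pair_topology Neg) (hat Neg a)"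
  unfolding pair_topology_def by (rule topology_generated_by_Basis) auto

lemma compactin_hat: "compactin (pair_topology Neg) (hat Neg a)"
  unfolding compactin_def
proof (intro conjI allI impI)
  show "hat Neg a \<subseteq> topspace (pair_topology Neg)"
    using hat_subset topspace_pair_topology by blast
  fix K assume K: "Ball K (openin (pair_topology Neg)) \<and> hat Neg a \<subseteq> \<Union> K"
  let ?p = "({b. a \<le> b}, {b. b \<le> Neg a})"
  have "?p \<in> hat Neg a" using principal_state by simp
  then obtain U where U: "U \<in> K" "?p \<in> U" using K by blast
  \<comment> \<open>Membership of \<open>?p\<close> in \<open>hat Neg b\<close> says
    \<open>a <= b\<close>, so the single member \<open>U\<close> covers
    \<open>hat Neg a\<close>.\<close>
  then obtain b where b: "?p \<in> hat Neg b" "hat Neg b \<subseteq> U" using K hat_basis by blast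
  then have "hat Neg a \<subseteq> hat Neg b" using hat_subset_iff by simp
  then show "\<exists>K'. finite K' \<and> K' \<subseteq> K \<and> hat Neg a \<subseteq> \<Union> K'"
    using U(1) b(2) by (intro exI[of _ "{U}"]) auto
qed

text \<open>Openness makes \<open>U\<close> a union of hats, compactness a finite one, and closing
  that union, which fixes \<open>U\<close>, yields the hat of the finite join.\<close>

lemma compact_open_fixpoints_eq: "compact_open_fixpoints Neg = range (hat Neg)"
proof (intro equalityI subsetI)
  fix U assume "U \<in> compact_open_fixpoints Neg"
  then have fixp: "frame_closure X pair_below U = U"
    and comp: "compactin (pair_topology Neg) U" and op: "openin (pair_topology Neg) U"
    unfolding compact_open_fixpoints_def frame_fixpoints_def by auto
  let ?K = "hat Neg ` {a. hat Neg a \<subseteq> U}"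
  have "Ball ?K (openin (pair_topology Neg))" "U \<subseteq> \<Union> ?K"
    using openin_hat hat_basis[OF op] by blast+
  then obtain K' where K': "finite K'" "K' \<subseteq> ?K" "U \<subseteq> \<Union> K'"
    using comp unfolding compactin_def by meson
  then obtain A where A: "finite A" "A \<subseteq> {a. hat Neg a \<subseteq> U}" "K' = hat Neg ` A"
    by (meson finite_subset_image)
  obtain s where s: "\<forall>I. lattice_ideal I \<longrightarrow> (s \<in> I \<longleftrightarrow> A \<subseteq> I)"
    using finite_join_ideal[OF A(1)] by blast
  have "U = (\<Union>a\<in>A. hat Neg a)" using A K'(3) by blast
  then have "U = hat Neg s" using fixp hat_join[of s A] s by simp
  then show "U \<in> range (hat Neg)" by blast
next
  fix U assume "U \<in> range (hat Neg)"
  then show "U \<in> compact_open_fixpoints Neg"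
    using hat_fixpoint openin_hat compactin_hat unfolding compact_open_fixpoints_def by auto
qed

section \<open>Pseudo-symmetry and pseudo-reflexivity\<close>

lemma pseudo_symmetric_states: "pseudo_symmetric X pair_below"
  unfolding pseudo_symmetric_def
proof (intro ballI impI)
  fix x y assume x: "x \<in> X" and y: "y \<in> X" and yx: "pair_below y x"
  obtain F I F' I' where eqs: "x = (F, I)" "y = (F', I')" by fastforce
  \<comment> \<open>Being above a point depends only on the filter, so keeping \<open>F\<close>
    gives pre-refinement at once. Shrinking the ideal to the least one makes \<open>?z\<close> below
    as much as possible.\<close>
  let ?z = "(F, {b. \<exists>a\<in>F. b \<le> Neg a})"
  have F: "lattice_filter F" using x eqs pair_statesD by blast
  \<comment> \<open>Self-adjointness moves \<open>Neg b\<close> into \<open>F\<close>, while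
    \<open>b\<close> in \<open>F'\<close> puts it in \<open>I'\<close>, against
    \<open>pair_below y x\<close>.\<close>
  have False if "b \<in> F'" "a \<in> F" "b \<le> Neg a" for a b
  proof -
    have "Neg b \<in> F" using neg_swap[OF that(3)] that(2) lattice_filter_up[OF F] by blast
    moreover have "Neg b \<in> I'" using that(1) y eqs pair_statesD(3) by blast
    ultimately show False using yx eqs by auto
  qed
  then have "pair_below ?z y" using eqs by auto
  moreover have "pre_refines X pair_below ?z x"
    unfolding pre_refines_def using eqs by auto
  ultimately show "\<exists>z\<in>X. pair_below z y \<and> pre_refines X pair_below z x"
    using filter_state[OF F] by blast
qed

lemma pseudo_reflexive_states:
  assumes "\<And>a. inf a (Neg a) = bot"
  shows "pseudo_reflexive X pair_below"
  unfolding pseudo_reflexive_def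
proof (intro ballI impI)
  fix x assume x: "x \<in> X" and na: "non_absurd X pair_below x"
  obtain F I where eqs: "x = (F, I)" by fastforce
  let ?z = "(F, {b. \<exists>a\<in>F. b \<le> Neg a})"
  have F: "lattice_filter F" using x eqs pair_statesD by blast
  \<comment> \<open>Any point below \<open>x\<close> has an ideal containing \<open>bot\<close> and
    disjoint from \<open>F\<close>.\<close>
  have bot: "bot \<notin> F"
    using na lattice_ideal_bot pair_statesD(2) eqs unfolding non_absurd_def by fastforce
  have False if "b \<in> F" "a \<in> F" "b \<le> Neg a" for a b
  proof -
    have "inf a b \<le> inf a (Neg a)" using that(3) by (rule inf_mono[OF order_refl])
    then show False using lattice_filter_inf[OF F that(2,1)] bot assms bot_unique by metis
  qed
  then have "pair_below ?z x" using eqs by auto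
  moreover have "pre_refines X pair_below ?z x"
    unfolding pre_refines_def using eqs by auto
  ultimately show "\<exists>z\<in>X. pair_below z x \<and> pre_refines X pair_below z x"
    using filter_state[OF F] by blast
qed

end

section \<open>Canonical successors and the modal operations\<close>

locale modal_neg_lattice = neg_lattice +
  fixes Box Dia :: "'a \<Rightarrow> 'a"
  assumes box: "multiplicative_op Box"
    and dia: "additive_op Dia"
    and dia_neg_le: "\<And>a. Dia (Neg a) \<le> Neg (Box a)"
begin

abbreviation "R \<equiv> pair_rel Box Dia"

lemma pair_rel_iff [simp]:
  "R (F, I) (F', I') \<longleftrightarrow> {a. Box a \<in> F} \<subseteq> F' \<and> {a. Dia a \<in> I} \<subseteq> I'"
  unfolding pair_rel_def by auto

lemma successor_state:
  assumes "(F, I) \<in> X"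
  shows "({a. Box a \<in> F}, {a. Dia a \<in> I}) \<in> X"
proof (rule pair_statesI)
  note D = pair_statesD[OF assms]
  have B: "Box top = top" "Box (inf a b) = inf (Box a) (Box b)" for a b
    using box unfolding multiplicative_op_def by auto
  have C: "Dia bot = bot" "Dia (sup a b) = sup (Dia a) (Dia b)" for a b
    using dia unfolding additive_op_def by auto
  show "lattice_filter {a. Box a \<in> F}"
    unfolding lattice_filter_def
    using lattice_filter_top[OF D(1)] lattice_filter_inf[OF D(1)] B
      lattice_filter_up[OF D(1)] monoD[OF multiplicative_op_mono[OF box]]
    by (auto intro!: exI[of _ top])
  show "lattice_ideal {a. Dia a \<in> I}"
    unfolding lattice_ideal_def
    using lattice_ideal_bot[OF D(2)] lattice_ideal_sup_iff[OF D(2)] C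
      lattice_ideal_down[OF D(2)] monoD[OF additive_op_mono[OF dia]]
    by (auto intro!: exI[of _ bot])
  \<comment> \<open>\<open>Box a\<close> in \<open>F\<close> puts \<open>Neg (Box a)\<close> in
    \<open>I\<close>, hence also the smaller \<open>Dia (Neg a)\<close>; this is where
    \<open>dia_neg_le\<close> enters.\<close>
  show "Neg a \<in> {a. Dia a \<in> I}" if "a \<in> {a. Box a \<in> F}" for a
    using that D(3) lattice_ideal_down[OF D(2) _ dia_neg_le] by auto
qed

lemma hat_box: "hat Neg (Box a) = frame_box X R (hat Neg a)"
proof (intro equalityI subsetI)
  fix x assume x: "x \<in> hat Neg (Box a)"
  have "y \<in> hat Neg a" if "y \<in> X" "R x y" for y
    using x that by (cases x; cases y) auto
  then show "x \<in> frame_box X R (hat Neg a)"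
    using x hat_subset unfolding frame_box_def by blast
next
  fix x assume x: "x \<in> frame_box X R (hat Neg a)"
  obtain F I where FI: "x = (F, I)" by fastforce
  have xX: "(F, I) \<in> X" using x FI unfolding frame_box_def by simp
  \<comment> \<open>The filter of this successor is the preimage of \<open>F\<close>, so
    \<open>a\<close> lies in it exactly when \<open>Box a\<close> is in \<open>F\<close>.\<close>
  have "({a. Box a \<in> F}, {a. Dia a \<in> I}) \<in> hat Neg a"
    using x FI successor_state[OF xX] unfolding frame_box_def by auto
  then show "x \<in> hat Neg (Box a)" using FI xX by simp
qed

lemma hat_dia: "hat Neg (Dia a) = frame_dia X pair_below R (hat Neg a)"
proof (intro equalityI subsetI)
  fix x assume x: "x \<in> hat Neg (Dia a)"
  have "\<exists>y'\<in>X. R x' y' \<and> (\<exists>y\<in>X. pair_below y' y \<and> y \<in> hat Neg a)"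
    if x': "x' \<in> X" "pair_below x' x" for x'
  proof -
    obtain F I where FI: "x' = (F, I)" by fastforce
    let ?y' = "({a. Box a \<in> F}, {a. Dia a \<in> I})" and ?y = "({b. a \<le> b}, {b. b \<le> Neg a})"
    have y': "?y' \<in> X" using successor_state x' FI by blast
    have "Dia a \<notin> I" using x x' FI by (cases x) auto
    \<comment> \<open>A common element \<open>b >= a\<close> would have \<open>Dia b\<close> in
      \<open>I\<close>; since the preimage is an ideal, \<open>Dia a\<close> would be in
      \<open>I\<close> too.\<close>
    then have "pair_below ?y' ?y"
      using lattice_ideal_down[OF pair_statesD(2)[OF y']] by auto
    moreover have "R x' ?y'" using FI by simp
    ultimately show ?thesis using y' principal_state[of a] hat_iff by blast
  qed
  then show "x \<in> frame_dia X pair_below R (hat Neg a)"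
    using x hat_subset unfolding frame_dia_def by blast
next
  fix x assume x: "x \<in> frame_dia X pair_below R (hat Neg a)"
  obtain F I where FI: "x = (F, I)" by fastforce
  have xX: "(F, I) \<in> X" using x FI unfolding frame_dia_def by simp
  have "Dia a \<in> F"
  proof (rule ccontr)
    assume "Dia a \<notin> F"
    then have "{b. b \<le> Dia a} \<inter> F = {}"
      using lattice_filter_up[OF pair_statesD(1)[OF xX]] by blast
    then have "pair_below ({top}, {b. b \<le> Dia a}) x" using FI by simp
    \<comment> \<open>The ideal of the test point contains \<open>Dia a\<close>, so \<open>a\<close>
      is in the ideal of \<open>y'\<close> as well as in the filter of \<open>y\<close>.\<close>
    then obtain y' y where
      "R ({top}, {b. b \<le> Dia a}) y'" "pair_below y' y" "y \<in> hat Neg a"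
      using x ideal_state[OF lattice_ideal_downset] unfolding frame_dia_def by blast
    then show False by (cases y; cases y') auto
  qed
  then show "x \<in> hat Neg (Dia a)" using FI xX by simp
qed

section \<open>Frame conditions on the accessibility relation\<close>

lemma modal_frame_states: "modal_frame X pair_below R R"
  unfolding modal_frame_def
proof (intro conjI ballI impI)
  show "X \<noteq> {}" using principal_state by blast
  fix x y z assume "x \<in> X" "y \<in> X" and z: "z \<in> X" and "R x y \<and> pair_below z y"
  obtain F I G J H K where eqs: "x = (F, I)" "y = (G, J)" "z = (H, K)" by fastforce
  have rel: "{a. Box a \<in> F} \<subseteq> G" "K \<inter> G = {}"
    using \<open>R x y \<and> pair_below z y\<close> eqs by auto
  \<comment> \<open>This ideal misses \<open>F\<close>, since \<open>Box b\<close> in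
    \<open>F\<close> would put \<open>b\<close> in \<open>K\<close> and \<open>G\<close>. A point
    above \<open>?x'\<close> has no \<open>Box b\<close> with \<open>b\<close> in \<open>K\<close>
    in its filter, so its canonical successor is above \<open>z\<close>.\<close>
  let ?x' = "({top}, {c. \<exists>b\<in>K. c \<le> Box b})"
  have F: "lattice_filter F" and K: "lattice_ideal K"
    using \<open>x \<in> X\<close> z eqs pair_statesD by blast+
  have "?x' \<in> X"
    using ideal_state lattice_ideal_generated_image[OF K multiplicative_op_mono[OF box]] .
  moreover have "pair_below ?x' x"
    using rel lattice_filter_up[OF F] eqs by fastforce
  moreover have "\<exists>y''\<in>X. R x'' y'' \<and> pair_below z y''"
    if "x'' \<in> X" "pair_below ?x' x''" for x''
  proof -
    obtain F' I' where FI: "x'' = (F', I')" by fastforce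
    have "K \<inter> {a. Box a \<in> F'} = {}" using that(2) FI by auto
    then show ?thesis
      using successor_state[of F' I'] that(1) FI eqs
      by (intro bexI[of _ "({a. Box a \<in> F'}, {a. Dia a \<in> I'})"]) auto
  qed
  ultimately show "\<exists>x'\<in>X. pair_below x' x \<and>
      (\<forall>x''\<in>X. pair_below x' x'' \<longrightarrow> (\<exists>y''\<in>X. R x'' y'' \<and> pair_below z y''))"
    by blast
qed

lemma dia_filter_state:
  assumes "lattice_filter H"
  defines "G \<equiv> {c. \<exists>b\<in>H. Dia b \<le> c}"
  shows "(G, {b. \<exists>a\<in>G. b \<le> Neg a}) \<in> X"
  using filter_state lattice_filter_generated_image[OF assms(1) additive_op_mono[OF dia]]
  unfolding G_def .

text \<open>Shared by additivity and negativity: the ideal of \<open>x\<close> contains no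
  \<open>Dia b\<close> with \<open>b\<close> in \<open>H\<close>, so the canonical successor has an
  ideal disjoint from \<open>H\<close>. The ideals \<open>J\<close> and \<open>K\<close> are free
  because \<open>pair_below\<close> reads only the filter on its right.\<close>

lemma dia_filter_state_back:
  assumes "x \<in> X" and "pair_below x ({c. \<exists>b\<in>H. Dia b \<le> c}, J)"
  shows "\<exists>y\<in>X. R x y \<and> pair_below y (H, K)"
proof -
  obtain F I where FI: "x = (F, I)" by fastforce
  have "{a. Dia a \<in> I} \<inter> H = {}" using assms(2) FI by auto
  then show ?thesis
    using successor_state[of F I] assms(1) FI
    by (intro bexI[of _ "({a. Box a \<in> F}, {a. Dia a \<in> I})"]) auto
qed

lemma additive_frame_states: "additive_frame X pair_below R R"
  unfolding additive_frame_def
proof (intro ballI impI)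
  fix x y z assume "x \<in> X" "y \<in> X" and z: "z \<in> X" and "R x y \<and> pair_below y z"
  obtain F I G J H K where eqs: "x = (F, I)" "y = (G, J)" "z = (H, K)" by fastforce
  have rel: "{a. Dia a \<in> I} \<subseteq> J" "J \<inter> H = {}"
    using \<open>R x y \<and> pair_below y z\<close> eqs by auto
  let ?G = "{c. \<exists>b\<in>H. Dia b \<le> c}"
  let ?x' = "(?G, {b. \<exists>a\<in>?G. b \<le> Neg a})"
  have I: "lattice_ideal I" and H: "lattice_filter H"
    using \<open>x \<in> X\<close> z eqs pair_statesD by blast+
  \<comment> \<open>If \<open>Dia b <= c\<close> with \<open>c\<close> in \<open>I\<close>, then
    \<open>Dia b\<close> is in \<open>I\<close>, which puts \<open>b\<close> in both
    \<open>J\<close> and \<open>H\<close>.\<close>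
  have "pair_below x ?x'"
    using rel lattice_ideal_down[OF I] eqs by fastforce
  then show "\<exists>x'\<in>X. pair_below x x' \<and>
      (\<forall>x''\<in>X. pair_below x'' x' \<longrightarrow> (\<exists>y''\<in>X. R x'' y'' \<and> pair_below y'' z))"
    using dia_filter_state[OF H] dia_filter_state_back eqs(3) by blast
qed

text \<open>The witness is the one used for additivity; what changes is that it must now lie below
  \<open>x\<close>.\<close>

lemma negative_frame_states:
  assumes neg_dia_le: "\<And>a. Neg (Dia a) \<le> Box (Neg a)"
  shows "negative_frame X pair_below R R"
  unfolding negative_frame_def
proof (intro ballI impI)
  fix x y z assume "x \<in> X" "y \<in> X" and z: "z \<in> X" and "R x y \<and> pair_below z y"
  obtain F I G J H K where eqs: "x = (F, I)" "y = (G, J)" "z = (H, K)" by fastforce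
  have rel: "{a. Box a \<in> F} \<subseteq> G" "K \<inter> G = {}"
    using \<open>R x y \<and> pair_below z y\<close> eqs by auto
  let ?G = "{c. \<exists>b\<in>H. Dia b \<le> c}"
  let ?x' = "(?G, {b. \<exists>a\<in>?G. b \<le> Neg a})"
  have F: "lattice_filter F" and H: "lattice_filter H"
    using \<open>x \<in> X\<close> z eqs pair_statesD by blast+
  \<comment> \<open>The chain \<open>b <= Neg a <= Neg (Dia h) <= Box (Neg h)\<close> puts
    \<open>Neg h\<close> in \<open>G\<close>, while \<open>h\<close> in \<open>H\<close> puts it in
    \<open>K\<close>.\<close>
  have False if "b \<in> F" "b \<le> Neg a" "Dia h \<le> a" "h \<in> H" for a b h
  proof -
    have "b \<le> Box (Neg h)"
      using that(2) neg_antimono[OF that(3)] neg_dia_le by (meson order_trans)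
    then have "Neg h \<in> G" using that(1) lattice_filter_up[OF F] rel(1) by blast
    moreover have "Neg h \<in> K" using that(4) z eqs pair_statesD(3) by blast
    ultimately show False using rel(2) by blast
  qed
  then have "pair_below ?x' x" using eqs by auto
  then show "\<exists>x'\<in>X. pair_below x' x \<and>
      (\<forall>x''\<in>X. pair_below x'' x' \<longrightarrow> (\<exists>y''\<in>X. R x'' y'' \<and> pair_below y'' z))"
    using dia_filter_state[OF H] dia_filter_state_back eqs(3) by blast
qed

section \<open>The embedding and its image\<close>

lemma hat_embedding:
  "is_embedding (hat Neg) (lattice_algebra Neg Box Dia) (fixpoint_algebra X pair_below R R)"
  unfolding is_embedding_def lattice_algebra_def fixpoint_algebra_def
  using hat_fixpoint inj_hat
  by (auto simp: hat_bot hat_top hat_inf hat_sup hat_neg hat_box hat_dia)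

end

text \<open>This gives closure of the compact open fixpoints under all operations without
  topological arguments, since they form the image of \<open>hat Neg\<close>.\<close>

lemma embedding_image_subalgebra:
  assumes f: "is_embedding f A B" and A: "is_subalgebra (alg_carrier A) A"
  shows "is_subalgebra (f ` alg_carrier A) B"
  using f A unfolding is_embedding_def is_subalgebra_def
  by (auto simp: image_iff) metis+

lemma embedding_image_isomorphic:
  assumes "is_embedding f A B"
  shows "isomorphic_algebras A (restrict_algebra B (f ` alg_carrier A))"
  using assms unfolding isomorphic_algebras_def restrict_algebra_def is_embedding_def by auto

theorem theorem5p3:
  fixes Neg Box Dia :: "'a::bounded_lattice \<Rightarrow> 'a"
  assumes "dually_self_adjoint Neg"
    and "Neg top = bot"
    and "multiplicative_op Box"
    and "additive_op Dia"
    and "\<And>a. Dia (Neg a) \<le> Neg (Box a)"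
  shows "let X = pair_states Neg; R = pair_rel Box Dia; Q = R;
             L = lattice_algebra Neg Box Dia;
             FX = fixpoint_algebra X pair_below R Q;
             S = compact_open_fixpoints Neg
         in
           (modal_frame X pair_below R Q \<and> unified_frame X R Q \<and>
            additive_frame X pair_below R Q \<and> pseudo_symmetric X pair_below) \<and>
           ((\<exists>f. is_embedding f L FX) \<and>
            is_subalgebra S FX \<and> isomorphic_algebras L (restrict_algebra FX S)) \<and>
           ((\<forall>a. inf a (Neg a) = bot) \<longrightarrow> pseudo_reflexive X pair_below) \<and>
           ((\<forall>a. Neg (Dia a) \<le> Box (Neg a)) \<longrightarrow> negative_frame X pair_below R Q)"
proof -
  interpret modal_neg_lattice Neg Box Dia
    by unfold_locales (use assms in auto)
  let ?L = "lattice_algebra Neg Box Dia"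
  have L: "is_subalgebra (alg_carrier ?L) ?L" and S: "hat Neg ` alg_carrier ?L = compact_open_fixpoints Neg"
    by (simp_all add: lattice_algebra_def is_subalgebra_def compact_open_fixpoints_eq)
  have "unified_frame X R R" unfolding unified_frame_def by simp
  then show ?thesis
    unfolding Let_def
    using modal_frame_states additive_frame_states pseudo_symmetric_states pseudo_reflexive_states
      negative_frame_states hat_embedding embedding_image_subalgebra[OF hat_embedding L]
      embedding_image_isomorphic[OF hat_embedding] S
    by auto
qed

end
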